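(* Let $\mu$ be a probability measure on $\{0,1\}^{[n]}$ and $t$ a positive integer. Suppose that for every $k\in\{1,\dots,t\}$, every measure obtained from $\mu$ by conditioning on the values of $n-2k$ coordinates has the antipodal pairs property (APP). Then the sequences $(\mu(|\eta|=i)/\binom{n}{i})_{i=0}^{t+1}$ and $(\mu(|\eta|=i)/\binom{n}{i})_{i=n-t-1}^{n}$ are log-concave.
   Context: Write $|\eta|=\sum\eta_i$, $\mathbf{1}=(1,\dots,1)$. For a probability measure $\nu$ on $\{0,1\}^S$ with $|S|=m$, $\gamma_i(\nu)=\binom{m}{i}^{-1}\sum\{\nu(\eta)\nu(\mathbf{1}-\eta):\eta\in\{0,1\}^S,|\eta|=i\}$; when $m=2k$, $\nu$ has the APP if $\gamma_k(\nu)\ge\gamma_{k-1}(\nu)$. Conditioning $\mu$ on the values of coordinates in $I\subseteq[n]$ means passing to $\mu(\cdot\mid\eta_i=\xi_i\ \forall i\in I)$ for some $\xi\in\{0,1\}^I$ with positive probability, regarded as a measure on $\{0,1\}^{[n]\setminus I}$. A sequence $(b_j)_{j=p}^q$ is log-concave if $b_j^2\ge b_{j-1}b_{j+1}$ for $p<j<q$. *)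

theory Defs
  imports "HOL-Probability.Probability"
begin

text \<open>Points of \<open>{0,1}\<^sup>S\<close> are the extensional functions on \<open>S\<close> with values in \<open>{0,1}\<close>; a probability
  measure on the finite set \<open>{0,1}\<^sup>S\<close> is a pmf whose support lies in \<open>cube S\<close>.\<close>

definition cube :: "'a set \<Rightarrow> ('a \<Rightarrow> nat) set" where
  "cube S = S \<rightarrow>\<^sub>E {0, 1}"

definition weight :: "'a set \<Rightarrow> ('a \<Rightarrow> nat) \<Rightarrow> nat" where
  "weight S \<eta> = (\<Sum>j\<in>S. \<eta> j)"

definition antipode :: "'a set \<Rightarrow> ('a \<Rightarrow> nat) \<Rightarrow> ('a \<Rightarrow> nat)" where
  "antipode S \<eta> = (\<lambda>j\<in>S. 1 - \<eta> j)"

definition antipodal_gamma :: "'a set \<Rightarrow> ('a \<Rightarrow> nat) pmf \<Rightarrow> nat \<Rightarrow> real" where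
  "antipodal_gamma S \<nu> i =
     (\<Sum>\<eta> | \<eta> \<in> cube S \<and> weight S \<eta> = i. pmf \<nu> \<eta> * pmf \<nu> (antipode S \<eta>)) / real (card S choose i)"

text \<open>The condition \<open>k \<ge> 1\<close> keeps the natural number \<open>k - 1\<close> from being truncated.\<close>

definition APP :: "'a set \<Rightarrow> ('a \<Rightarrow> nat) pmf \<Rightarrow> bool" where
  "APP S \<nu> \<longleftrightarrow>
     (\<exists>k\<ge>1. card S = 2 * k \<and> antipodal_gamma S \<nu> k \<ge> antipodal_gamma S \<nu> (k - 1))"

definition agree_on :: "'a set \<Rightarrow> ('a \<Rightarrow> nat) \<Rightarrow> ('a \<Rightarrow> nat) set" where
  "agree_on I \<xi> = {\<eta>. \<forall>i\<in>I. \<eta> i = \<xi> i}"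

text \<open>The result is regarded as a measure on \<open>{0,1}\<close> to the power \<open>S - I\<close>. It is meaningful only if
  \<open>agree_on I \<xi>\<close> has positive probability, as \<^const>\<open>cond_pmf\<close> is unspecified otherwise.\<close>

definition conditioning :: "'a set \<Rightarrow> ('a \<Rightarrow> nat) pmf \<Rightarrow> 'a set \<Rightarrow> ('a \<Rightarrow> nat) \<Rightarrow> ('a \<Rightarrow> nat) pmf" where
  "conditioning S \<mu> I \<xi> = map_pmf (\<lambda>\<eta>. restrict \<eta> (S - I)) (cond_pmf \<mu> (agree_on I \<xi>))"

definition log_concave_between :: "nat \<Rightarrow> nat \<Rightarrow> (nat \<Rightarrow> real) \<Rightarrow> bool" where
  "log_concave_between p q b \<longleftrightarrow> (\<forall>j. p < j \<and> j < q \<longrightarrow> (b j)\<^sup>2 \<ge> b (j - 1) * b (j + 1))"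

text \<open>For \<open>i > n\<close> the value is \<open>0 / 0 = 0\<close>.\<close>

definition normalized_rank :: "nat \<Rightarrow> (nat \<Rightarrow> nat) pmf \<Rightarrow> nat \<Rightarrow> real" where
  "normalized_rank n \<mu> i =
     measure_pmf.prob \<mu> {\<eta>. weight {1..n} \<eta> = i} / real (n choose i)"

end

theory Submission
  imports Defs
begin

text \<open>Let \<open>a\<^sub>i = \<mu>(|\<eta>| = i)\<close>, identify \<open>\<eta>\<close> with its support, and sort the pairs \<open>(A, B)\<close> in the
  expansions of \<open>a\<^sub>j\<^sup>2\<close> and \<open>a\<^sub>j\<^sub>-\<^sub>1 a\<^sub>j\<^sub>+\<^sub>1\<close> by \<open>A \<inter> B\<close> and the symmetric difference, of size \<open>2k\<close>. The APP,
  applied after conditioning on the coordinates outside the symmetric difference, gives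
  \<open>a\<^sub>j\<^sub>-\<^sub>1 a\<^sub>j\<^sub>+\<^sub>1 \<le> a\<^sub>j\<^sup>2 - Q\<close> with \<open>Q = \<Sum> \<mu>(A) \<mu>(B) / (|A - B| + 1)\<close> over \<open>|A| = |B| = j\<close>. The kernel
  \<open>1 / (|A - B| + 1)\<close> is the sum of \<open>1 / ((j + 1) (j choose |C|))\<close> over \<open>C \<subseteq> A \<inter> B\<close>, so that \<open>Q\<close> is a
  positive combination of squares, and Cauchy-Schwarz on each level of \<open>C\<close> yields exactly the
  bound on \<open>Q\<close> that is needed.\<close>

abbreviation layer :: "'a set \<Rightarrow> nat \<Rightarrow> 'a set set" where
  "layer S i \<equiv> {A. A \<subseteq> S \<and> card A = i}"

section \<open>Binomial identities and the expansion of the kernel\<close>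

lemma binomial_Suc_step:
  assumes "k \<le> n"
  shows "(real k + 1) * real (n choose Suc k) = (real n - real k) * real (n choose k)"
proof -
  have "Suc k * (n choose Suc k) = (n - k) * (n choose k)"
    by (simp only: binomial_absorption binomial_absorb_comp)
  then have "real (Suc k) * real (n choose Suc k) = real (n - k) * real (n choose k)"
    unfolding of_nat_mult[symmetric] by (rule arg_cong)
  then show ?thesis
    using assms by (simp add: of_nat_diff add.commute)
qed

text \<open>Each ratio equals \<open>((j - s) choose (i - s)) / (j choose i)\<close>, and the
  numerators add up along a diagonal of Pascal's triangle to \<open>Suc j choose i\<close>. It
  serves twice: to expand the kernel, and to add up the Cauchy-Schwarz bounds over all
  levels.\<close>

lemma sum_binomial_ratio:
  assumes "i \<le> j"
  shows "(\<Sum>s\<le>i. real (i choose s) / real (j choose s)) = (real j + 1) / (real j + 1 - real i)"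
proof -
  have pos: "real (j choose i) > 0"
    using assms by simp
  have "real (i choose s) / real (j choose s) = real ((j - s) choose (i - s)) / real (j choose i)"
    if "s \<le> i" for s
  proof -
    have "real (j choose i) * real (i choose s) = real (j choose s) * real ((j - s) choose (i - s))"
      using choose_mult[OF that assms] by (metis of_nat_mult)
    moreover have "real (j choose s) > 0"
      using that assms by simp
    ultimately show ?thesis
      using pos by (simp add: field_simps)
  qed
  then have "(\<Sum>s\<le>i. real (i choose s) / real (j choose s))
      = (\<Sum>s\<le>i. real ((j - s) choose (i - s)) / real (j choose i))"
    by (intro sum.cong) auto
  also have "\<dots> = real (\<Sum>s\<le>i. (j - s) choose (i - s)) / real (j choose i)"
    by (simp add: sum_divide_distrib)
  also have "\<dots> = real (Suc j choose i) / real (j choose i)"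
    using sum_choose_diagonal[OF assms] by simp
  also have "\<dots> = (real j + 1) / (real j + 1 - real i)"
  proof -
    have "real (Suc j - i) * real (Suc j choose i) = real (Suc j) * real (j choose i)"
      using binomial_absorb_comp[of "Suc j" i] by (metis diff_Suc_1 of_nat_mult)
    moreover have "real (Suc j - i) = real j + 1 - real i"
      using assms by (simp add: of_nat_diff)
    ultimately show ?thesis
      using pos assms by (simp add: field_simps)
  qed
  finally show ?thesis .
qed

lemma sum_Pow_card:
  fixes g :: "nat \<Rightarrow> real"
  assumes "finite X"
  shows "(\<Sum>C\<in>Pow X. g (card C)) = (\<Sum>s\<le>card X. real (card X choose s) * g s)"
proof -
  have "(\<Sum>C\<in>Pow X. g (card C)) = (\<Sum>s\<le>card X. \<Sum>C\<in>{C \<in> Pow X. card C = s}. g (card C))"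
    using assms by (intro sum.group[symmetric]) (auto intro: card_mono)
  also have "\<dots> = (\<Sum>s\<le>card X. real (card X choose s) * g s)"
    using n_subsets[OF assms] by (intro sum.cong) auto
  finally show ?thesis .
qed

text \<open>The summand depends only on the size of \<open>C\<close>, so grouping by size leads to
  \<open>sum_binomial_ratio\<close> with \<open>i = card (A \<inter> B)\<close>, where
  \<open>j - i = card (A - B)\<close>.\<close>

lemma inverse_card_Diff_eq_sum:
  assumes "finite A" "card A = j"
  shows "1 / (real (card (A - B)) + 1)
    = (\<Sum>C\<in>Pow (A \<inter> B). 1 / ((real j + 1) * real (j choose card C)))"
proof -
  let ?i = "card (A \<inter> B)"
  have i: "?i \<le> j" and d: "card (A - B) = j - ?i"
    using assms by (auto intro: card_mono simp: card_Diff_subset_Int)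
  have "(\<Sum>C\<in>Pow (A \<inter> B). 1 / ((real j + 1) * real (j choose card C)))
      = (\<Sum>s\<le>?i. real (?i choose s) * (1 / ((real j + 1) * real (j choose s))))"
    using assms by (intro sum_Pow_card) auto
  also have "\<dots> = (\<Sum>s\<le>?i. real (?i choose s) / real (j choose s)) / (real j + 1)"
    by (simp add: sum_divide_distrib field_simps)
  also have "\<dots> = 1 / (real j + 1 - real ?i)"
    using i by (simp add: sum_binomial_ratio)
  finally show ?thesis
    using i d by (simp add: of_nat_diff algebra_simps)
qed

section \<open>The quadratic form of the kernel\<close>

text \<open>The form is a weighted sum of squares of the up-set sums \<open>F C\<close>, bounded
  level by level. Nothing is lost for constant \<open>f\<close>: there \<open>F\<close> is constant
  on each level, and equality holds.\<close>

lemma sum_kernel_ge: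
  fixes f :: "'a set \<Rightarrow> real"
  assumes S: "finite S" and j: "j \<le> card S"
  shows "(\<Sum>A\<in>layer S j. \<Sum>B\<in>layer S j. f A * f B / (real (card (A - B)) + 1))
    \<ge> (\<Sum>A\<in>layer S j. f A)\<^sup>2 * (real (card S) + 1) / ((real j + 1) * (real (card S) + 1 - real j))"
proof -
  let ?n = "card S" and ?L = "layer S j"
  define w where "w s = 1 / ((real j + 1) * real (j choose s))" for s
  define F where "F C = (\<Sum>A\<in>?L. if C \<subseteq> A then f A else 0)" for C
  have w0: "w s \<ge> 0" for s
    by (simp add: w_def)
  have fin: "finite A" if "A \<subseteq> S" for A
    using that S finite_subset by blast
  have "(\<Sum>A\<in>?L. \<Sum>B\<in>?L. f A * f B / (real (card (A - B)) + 1))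
      = (\<Sum>A\<in>?L. \<Sum>B\<in>?L. \<Sum>C\<in>Pow S.
          w (card C) * ((if C \<subseteq> A then f A else 0) * (if C \<subseteq> B then f B else 0)))"
  proof (intro sum.cong refl)
    fix A B assume A: "A \<in> ?L" and B: "B \<in> ?L"
    have "f A * f B / (real (card (A - B)) + 1) = f A * f B * (1 / (real (card (A - B)) + 1))"
      by simp
    also have "\<dots> = f A * f B * (\<Sum>C\<in>Pow (A \<inter> B). w (card C))"
      using A fin by (subst inverse_card_Diff_eq_sum[where j = j]) (auto simp: w_def)
    also have "\<dots> = (\<Sum>C\<in>Pow (A \<inter> B). w (card C) * (f A * f B))"
      by (simp add: sum_distrib_left mult_ac)
    \<comment> \<open>The indicators free the range of \<open>C\<close> from \<open>A\<close> and
      \<open>B\<close>, so that the summation over \<open>C\<close> can be moved outside.\<close>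
    also have "\<dots> = (\<Sum>C\<in>Pow S.
          w (card C) * ((if C \<subseteq> A then f A else 0) * (if C \<subseteq> B then f B else 0)))"
      using A S by (intro sum.mono_neutral_cong_left) auto
    finally show "f A * f B / (real (card (A - B)) + 1) = \<dots>" .
  qed
  also have "\<dots> = (\<Sum>A\<in>?L. \<Sum>C\<in>Pow S. \<Sum>B\<in>?L.
          w (card C) * ((if C \<subseteq> A then f A else 0) * (if C \<subseteq> B then f B else 0)))"
    by (intro sum.cong refl sum.swap)
  also have "\<dots> = (\<Sum>C\<in>Pow S. \<Sum>A\<in>?L. \<Sum>B\<in>?L.
          w (card C) * ((if C \<subseteq> A then f A else 0) * (if C \<subseteq> B then f B else 0)))"
    by (rule sum.swap)
  also have "\<dots> = (\<Sum>C\<in>Pow S. w (card C) * (F C)\<^sup>2)"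
    unfolding F_def power2_eq_square sum_product by (simp add: sum_distrib_left)
  also have "\<dots> = (\<Sum>s\<le>?n. \<Sum>C\<in>{C \<in> Pow S. card C = s}. w (card C) * (F C)\<^sup>2)"
    using S by (intro sum.group[symmetric]) (auto intro: card_mono)
  also have "\<dots> = (\<Sum>s\<le>?n. w s * (\<Sum>C\<in>layer S s. (F C)\<^sup>2))"
    by (simp add: sum_distrib_left)
  finally have Q: "(\<Sum>A\<in>?L. \<Sum>B\<in>?L. f A * f B / (real (card (A - B)) + 1))
      = (\<Sum>s\<le>?n. w s * (\<Sum>C\<in>layer S s. (F C)\<^sup>2))" .
  \<comment> \<open>Double counting: every \<open>A\<close> of size \<open>j\<close> contains
    \<open>j choose s\<close> sets \<open>C\<close> of size \<open>s\<close>.\<close>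
  have F_sum: "(\<Sum>C\<in>layer S s. F C) = real (j choose s) * (\<Sum>A\<in>?L. f A)" for s
  proof -
    have "(\<Sum>C\<in>layer S s. F C) = (\<Sum>A\<in>?L. \<Sum>C\<in>layer S s. if C \<subseteq> A then f A else 0)"
      unfolding F_def by (rule sum.swap)
    also have "\<dots> = (\<Sum>A\<in>?L. real (j choose s) * f A)"
    proof (intro sum.cong refl)
      fix A assume A: "A \<in> ?L"
      have "(\<Sum>C\<in>layer S s. if C \<subseteq> A then f A else 0) = (\<Sum>C\<in>layer A s. f A)"
        using A S by (intro sum.mono_neutral_cong_right) auto
      then show "(\<Sum>C\<in>layer S s. if C \<subseteq> A then f A else 0) = real (j choose s) * f A"
        using A n_subsets[OF fin, of A s] by simp
    qed
    finally show ?thesis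
      by (simp add: sum_distrib_left)
  qed
  have level: "w s * (\<Sum>C\<in>layer S s. (F C)\<^sup>2)
      \<ge> (\<Sum>A\<in>?L. f A)\<^sup>2 / (real j + 1) * (real (j choose s) / real (?n choose s))" if "s \<le> j" for s
  proof -
    have pos: "real (j choose s) > 0" "real (?n choose s) > 0"
      using that j by simp_all
    \<comment> \<open>Cauchy-Schwarz against the constant 1, whose squares sum to the size of the
      layer.\<close>
    have "(\<Sum>C\<in>layer S s. F C)\<^sup>2 \<le> (\<Sum>C\<in>layer S s. (F C)\<^sup>2) * real (?n choose s)"
      using Cauchy_Schwarz_ineq_sum[of F "\<lambda>_. 1" "layer S s"] n_subsets[OF S, of s] by simp
    then have "(real (j choose s) * (\<Sum>A\<in>?L. f A))\<^sup>2 / real (?n choose s) \<le> (\<Sum>C\<in>layer S s. (F C)\<^sup>2)"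
      using pos by (simp add: F_sum field_simps)
    then have "w s * ((real (j choose s) * (\<Sum>A\<in>?L. f A))\<^sup>2 / real (?n choose s))
        \<le> w s * (\<Sum>C\<in>layer S s. (F C)\<^sup>2)"
      using w0 by (rule mult_left_mono)
    moreover have "(\<Sum>A\<in>?L. f A)\<^sup>2 / (real j + 1) * (real (j choose s) / real (?n choose s))
        = w s * ((real (j choose s) * (\<Sum>A\<in>?L. f A))\<^sup>2 / real (?n choose s))"
      using pos by (simp add: w_def power2_eq_square)
    ultimately show ?thesis
      by (simp only:)
  qed
  \<comment> \<open>This is \<open>sum_binomial_ratio\<close> again, now with \<open>j\<close> and
    \<open>card S\<close> in the roles of \<open>i\<close> and \<open>j\<close>.\<close>
  have "(\<Sum>A\<in>?L. f A)\<^sup>2 * (real ?n + 1) / ((real j + 1) * (real ?n + 1 - real j))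
      = (\<Sum>s\<le>j. (\<Sum>A\<in>?L. f A)\<^sup>2 / (real j + 1) * (real (j choose s) / real (?n choose s)))"
    unfolding sum_distrib_left[symmetric] using j by (simp add: sum_binomial_ratio)
  also have "\<dots> \<le> (\<Sum>s\<le>j. w s * (\<Sum>C\<in>layer S s. (F C)\<^sup>2))"
    by (intro sum_mono level) simp
  also have "\<dots> \<le> (\<Sum>s\<le>?n. w s * (\<Sum>C\<in>layer S s. (F C)\<^sup>2))"
    using j by (intro sum_mono2) (auto intro!: mult_nonneg_nonneg w0 sum_nonneg)
  finally show ?thesis
    using Q by simp
qed

section \<open>Sorting pairs of sets by intersection and symmetric difference\<close>

text \<open>The bijection takes \<open>J = A \<inter> B\<close>, \<open>D\<close> the symmetric
  difference and \<open>E = A - B\<close>. For fixed \<open>J\<close> and \<open>D\<close> only the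
  splitting of \<open>D\<close> into \<open>E\<close> and \<open>D - E\<close> varies, and these two
  are antipodal in the cube over \<open>D\<close>.\<close>

lemma sum_pairs_by_intersection:
  fixes g :: "'a set \<Rightarrow> 'a set \<Rightarrow> real"
  assumes S: "finite S"
  shows "(\<Sum>(A, B)\<in>{(A, B). A \<in> layer S (c + e) \<and> B \<in> layer S (c + d) \<and> card (A - B) = e}. g A B)
    = (\<Sum>(J, D)\<in>{(J, D). J \<in> layer S c \<and> D \<in> layer S (e + d) \<and> J \<inter> D = {}}.
         \<Sum>E\<in>layer D e. g (J \<union> E) (J \<union> (D - E)))"
proof -
  have fin: "finite A" if "A \<subseteq> S" for A
    using that S finite_subset by blast
  let ?P = "{(J, D). J \<in> layer S c \<and> D \<in> layer S (e + d) \<and> J \<inter> D = {}}"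
  have finP: "finite ?P"
    by (rule finite_subset[of _ "Pow S \<times> Pow S"]) (use S in auto)
  have "(\<Sum>(J, D)\<in>?P. \<Sum>E\<in>layer D e. g (J \<union> E) (J \<union> (D - E)))
      = (\<Sum>p\<in>?P. \<Sum>E\<in>layer (snd p) e. g (fst p \<union> E) (fst p \<union> (snd p - E)))"
    by (simp add: case_prod_unfold)
  also have "\<dots> = (\<Sum>(p, E)\<in>(SIGMA p:?P. layer (snd p) e). g (fst p \<union> E) (fst p \<union> (snd p - E)))"
    using finP fin by (intro sum.Sigma) auto
  also have "\<dots> = (\<Sum>(A, B)\<in>{(A, B). A \<in> layer S (c + e) \<and> B \<in> layer S (c + d) \<and> card (A - B) = e}. g A B)"
  proof (rule sum.reindex_bij_witness[where
        j = "\<lambda>(p, E). (fst p \<union> E, fst p \<union> (snd p - E))" and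
        i = "\<lambda>(A, B). ((A \<inter> B, (A - B) \<union> (B - A)), A - B)"], goal_cases)
    case (1 x)
    then obtain J D E where "x = ((J, D), E)" "E \<subseteq> D" "J \<inter> D = {}"
      by auto
    moreover from this have "J \<inter> E = {}"
      by blast
    ultimately show ?case by auto
  next
    case (2 x)
    obtain J D E where x: "x = ((J, D), E)"
      by (metis prod.exhaust)
    with 2 have J: "J \<subseteq> S" "card J = c" and D: "D \<subseteq> S" "card D = e + d" "J \<inter> D = {}"
      and E: "E \<subseteq> D" "card E = e"
      by simp_all
    have finite: "finite J" "finite D" "finite E"
      using fin J D E by auto
    have "card (J \<union> E) = c + e"
      using J D E finite by (subst card_Un_disjoint) auto
    moreover have "card (J \<union> (D - E)) = c + d"
      using J D E finite by (subst card_Un_disjoint) (auto simp: card_Diff_subset)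
    moreover have "J \<union> E - (J \<union> (D - E)) = E"
      using D E by auto
    ultimately show ?case
      using x J D E by auto
  next
    case (3 x)
    then show ?case by auto
  next
    case (4 x)
    obtain A B where x: "x = (A, B)"
      by (metis prod.exhaust)
    with 4 have A: "A \<subseteq> S" "card A = c + e" and B: "B \<subseteq> S" "card B = c + d" and e: "card (A - B) = e"
      by simp_all
    have finite: "finite A" "finite B"
      using fin A B by auto
    have "card (A \<inter> B) = c"
      using card_Int_Diff[OF finite(1), of B] A e by simp
    moreover from this have "card (B - A) = d"
      using card_Int_Diff[OF finite(2), of A] B by (simp add: Int_commute)
    moreover have "card ((A - B) \<union> (B - A)) = card (A - B) + card (B - A)"
      using finite by (intro card_Un_disjoint) auto
    ultimately show ?case
      using x A B e by auto
  next
    case (5 x)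
    then show ?case by auto
  qed
  finally show ?thesis by simp
qed

lemma sum_product_by_Diff:
  fixes g :: "'a set \<Rightarrow> 'a set \<Rightarrow> real"
  assumes S: "finite S" and "i \<le> m"
  shows "(\<Sum>A\<in>layer S i. \<Sum>B\<in>layer S l. g A B)
    = (\<Sum>e\<le>m. \<Sum>(A, B)\<in>{(A, B). A \<in> layer S i \<and> B \<in> layer S l \<and> card (A - B) = e}. g A B)"
proof -
  let ?P = "layer S i \<times> layer S l"
  have "(\<Sum>A\<in>layer S i. \<Sum>B\<in>layer S l. g A B) = (\<Sum>(A, B)\<in>?P. g A B)"
    by (rule sum.cartesian_product)
  also have "\<dots> = (\<Sum>e\<le>m. \<Sum>(A, B)\<in>{x \<in> ?P. card (fst x - snd x) = e}. g A B)"
  proof (rule sum.group[symmetric])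
    show "(\<lambda>x. card (fst x - snd x)) ` ?P \<subseteq> {..m}"
    proof clarsimp
      fix A B assume "A \<subseteq> S" "i = card A"
      then have "card (A - B) \<le> i"
        using S by (auto intro: card_mono finite_subset)
      then show "card (A - B) \<le> m"
        using \<open>i \<le> m\<close> by simp
    qed
  qed (use S in auto)
  also have "\<dots> = (\<Sum>e\<le>m. \<Sum>(A, B)\<in>{(A, B). A \<in> layer S i \<and> B \<in> layer S l \<and> card (A - B) = e}. g A B)"
    by (intro sum.cong) auto
  finally show ?thesis .
qed

section \<open>Log-concavity for functions on finite sets\<close>

text \<open>The premise \<open>app\<close> is the APP without denominators, since the middle
  binomial coefficient of \<open>2 * k\<close> is \<open>(k + 1) / k\<close> times its neighbour.
  Summed over \<open>J\<close> and \<open>D\<close> it costs a factor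
  \<open>k / (k + 1) = 1 - 1 / (k + 1)\<close>, whose subtracted part is the kernel.\<close>

lemma log_concave_of_antipodal:
  fixes f :: "'a set \<Rightarrow> real"
  assumes S: "finite S" and j: "0 < j" "j < card S"
    and app: "\<And>k J D. \<lbrakk>1 \<le> k; k \<le> j; k \<le> card S - j; J \<subseteq> S; D \<subseteq> S; J \<inter> D = {}; card D = 2 * k\<rbrakk> \<Longrightarrow>
      (real k + 1) * (\<Sum>E\<in>layer D (k - 1). f (J \<union> E) * f (J \<union> (D - E)))
        \<le> real k * (\<Sum>E\<in>layer D k. f (J \<union> E) * f (J \<union> (D - E)))"
  defines "b \<equiv> \<lambda>i. (\<Sum>A\<in>layer S i. f A) / real (card S choose i)"
  shows "b (j - 1) * b (j + 1) \<le> (b j)\<^sup>2"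
proof -
  let ?n = "card S"
  define a where "a i = (\<Sum>A\<in>layer S i. f A)" for i
  define T where "T i l e = (\<Sum>(A, B)\<in>{(A, B). A \<in> layer S i \<and> B \<in> layer S l \<and> card (A - B) = e}. f A * f B)"
    for i l e
  have T_le: "(real k + 1) * T (j - 1) (j + 1) (k - 1) \<le> real k * T j j k" if k: "1 \<le> k" "k \<le> j" for k
  proof -
    \<comment> \<open>One index set serves both sides: sizes \<open>j - 1\<close>,
      \<open>j + 1\<close> with \<open>card (A - B) = k - 1\<close> and sizes \<open>j\<close>,
      \<open>j\<close> with \<open>card (A - B) = k\<close> both give an intersection of size
      \<open>j - k\<close> and a symmetric difference of size \<open>2 * k\<close>.\<close>
    define P where "P = {(J, D). J \<in> layer S (j - k) \<and> D \<in> layer S (2 * k) \<and> J \<inter> D = {}}"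
    have idx: "j - k + (k - 1) = j - 1" "j - k + (k + 1) = j + 1" "k - 1 + (k + 1) = 2 * k"
      "j - k + k = j" "k + k = 2 * k"
      using k by auto
    have "T (j - 1) (j + 1) (k - 1)
        = (\<Sum>(J, D)\<in>P. \<Sum>E\<in>layer D (k - 1). f (J \<union> E) * f (J \<union> (D - E)))"
      unfolding T_def P_def
      using sum_pairs_by_intersection[OF S, where c = "j - k" and e = "k - 1" and d = "k + 1" and
          g = "\<lambda>A B. f A * f B"] unfolding idx .
    moreover have "T j j k = (\<Sum>(J, D)\<in>P. \<Sum>E\<in>layer D k. f (J \<union> E) * f (J \<union> (D - E)))"
      unfolding T_def P_def
      using sum_pairs_by_intersection[OF S, where c = "j - k" and e = k and d = k and
          g = "\<lambda>A B. f A * f B"] unfolding idx .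
    moreover have "(real k + 1) * (\<Sum>E\<in>layer D (k - 1). f (J \<union> E) * f (J \<union> (D - E)))
        \<le> real k * (\<Sum>E\<in>layer D k. f (J \<union> E) * f (J \<union> (D - E)))" if "(J, D) \<in> P" for J D
    proof (rule app)
      have J: "J \<subseteq> S" "card J = j - k" and D: "D \<subseteq> S" "card D = 2 * k" "J \<inter> D = {}"
        using that by (auto simp: P_def)
      have "card (J \<union> D) = card J + card D"
        using J D S by (intro card_Un_disjoint) (auto intro: finite_subset)
      moreover have "card (J \<union> D) \<le> ?n"
        using J D S by (intro card_mono) auto
      ultimately show "k \<le> ?n - j"
        using J D k by simp
    qed (use that k in \<open>auto simp: P_def\<close>)
    ultimately show ?thesis
      by (simp add: sum_distrib_left) (auto intro!: sum_mono simp: sum_distrib_left)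
  qed
  have "a (j - 1) * a (j + 1) = (\<Sum>A\<in>layer S (j - 1). \<Sum>B\<in>layer S (j + 1). f A * f B)"
    unfolding a_def by (rule sum_product)
  also have "\<dots> = (\<Sum>e\<le>j - 1. T (j - 1) (j + 1) e)"
    unfolding T_def by (rule sum_product_by_Diff[OF S]) simp
  also have "\<dots> \<le> (\<Sum>e\<le>j - 1. (real e + 1) / (real e + 2) * T j j (Suc e))"
  proof (rule sum_mono)
    fix e assume "e \<in> {..j - 1}"
    then show "T (j - 1) (j + 1) e \<le> (real e + 1) / (real e + 2) * T j j (Suc e)"
      using T_le[of "Suc e"] j by (simp add: field_simps)
  qed
  \<comment> \<open>An index shift; the added term at \<open>e = 0\<close> has coefficient
    0.\<close>
  also have "\<dots> = (\<Sum>e\<le>j. real e / (real e + 1) * T j j e)"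
    using j sum.atMost_Suc_shift[of "\<lambda>e. real e / (real e + 1) * T j j e" "j - 1"]
    by (simp add: add_ac)
  also have "\<dots> = (\<Sum>e\<le>j. \<Sum>(A, B)\<in>{(A, B). A \<in> layer S j \<and> B \<in> layer S j \<and> card (A - B) = e}.
      f A * f B - f A * f B / (real (card (A - B)) + 1))"
    unfolding T_def by (simp add: sum_distrib_left case_prod_unfold) (auto intro!: sum.cong simp: field_simps)
  also have "\<dots> = (\<Sum>A\<in>layer S j. \<Sum>B\<in>layer S j. f A * f B - f A * f B / (real (card (A - B)) + 1))"
    by (rule sum_product_by_Diff[OF S, symmetric]) simp
  also have "\<dots> = (a j)\<^sup>2 - (\<Sum>A\<in>layer S j. \<Sum>B\<in>layer S j. f A * f B / (real (card (A - B)) + 1))"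
    unfolding a_def power2_eq_square sum_product by (simp add: sum_subtractf)
  also have "\<dots> \<le> (a j)\<^sup>2 - (a j)\<^sup>2 * (real ?n + 1) / ((real j + 1) * (real ?n + 1 - real j))"
    unfolding a_def using sum_kernel_ge[OF S, of j f] j by simp
  \<comment> \<open>With \<open>n = card S\<close>, this rests on
    \<open>(j + 1) * (n + 1 - j) = (n + 1) + j * (n - j)\<close>.\<close>
  also have "\<dots> = (a j)\<^sup>2 * (real j * (real ?n - real j)) / ((real j + 1) * (real ?n + 1 - real j))"
  proof -
    have "(real j + 1) * (real ?n + 1 - real j) \<noteq> 0"
      using j by simp
    then show ?thesis
      by (simp add: divide_simps) (simp add: algebra_simps)
  qed
  finally have main: "a (j - 1) * a (j + 1)
      \<le> (a j)\<^sup>2 * (real j * (real ?n - real j)) / ((real j + 1) * (real ?n + 1 - real j))" .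
  obtain i where i: "j = Suc i"
    using j by (cases j) auto
  let ?c = "\<lambda>i. real (?n choose i)"
  have pos: "?c (j - 1) > 0" "?c j > 0" "?c (j + 1) > 0"
    using j by simp_all
  have up: "(real j + 1) * ?c (j + 1) = (real ?n - real j) * ?c j"
    using binomial_Suc_step[of j ?n] j by simp
  have down: "real j * ?c j = (real ?n + 1 - real j) * ?c (j - 1)"
    using binomial_Suc_step[of i ?n] i j by (simp add: algebra_simps)
  have "a (j - 1) * a (j + 1) * (?c j)\<^sup>2 \<le> (a j)\<^sup>2 * (?c (j - 1) * ?c (j + 1))"
  proof -
    have q: "(real j + 1) * (real ?n + 1 - real j) > 0"
      using j by simp
    \<comment> \<open>The factor in \<open>main\<close> is exactly
      \<open>?c (j - 1) * ?c (j + 1) / (?c j)\<^sup>2\<close>, so passing to the normalized sequence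
      loses nothing.\<close>
    have "real j * (real ?n - real j) * (?c j)\<^sup>2
        = (real j + 1) * (real ?n + 1 - real j) * (?c (j - 1) * ?c (j + 1))"
    proof -
      have "real j * (real ?n - real j) * (?c j)\<^sup>2 = (real j * ?c j) * ((real ?n - real j) * ?c j)"
        by (simp add: power2_eq_square mult_ac)
      also have "\<dots> = ((real ?n + 1 - real j) * ?c (j - 1)) * ((real j + 1) * ?c (j + 1))"
        by (simp only: down up)
      finally show ?thesis
        by (simp only: mult_ac)
    qed
    then have "(a j)\<^sup>2 * (real j * (real ?n - real j)) / ((real j + 1) * (real ?n + 1 - real j)) * (?c j)\<^sup>2
        = (a j)\<^sup>2 * (?c (j - 1) * ?c (j + 1))"
      using q by (simp add: nonzero_divide_eq_eq mult.assoc)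
    then show ?thesis
      using mult_right_mono[OF main, of "(?c j)\<^sup>2"] by simp
  qed
  then show ?thesis
    unfolding b_def a_def[symmetric] using pos
    by (simp add: power_divide divide_le_eq le_divide_eq field_simps)
qed

section \<open>Points of the cube as sets\<close>

definition vertex :: "'a set \<Rightarrow> 'a set \<Rightarrow> ('a \<Rightarrow> nat)" where
  "vertex S A = (\<lambda>i\<in>S. if i \<in> A then 1 else 0)"

lemma vertex_in_cube: "vertex S A \<in> cube S"
  by (auto simp: vertex_def cube_def)

lemma weight_vertex: "finite S \<Longrightarrow> A \<subseteq> S \<Longrightarrow> weight S (vertex S A) = card A"
  by (simp add: weight_def vertex_def sum.If_cases Int_absorb1)

lemma vertex_support: "\<eta> \<in> cube S \<Longrightarrow> vertex S {i \<in> S. 0 < \<eta> i} = \<eta>"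
  by (fastforce simp: vertex_def cube_def PiE_iff extensional_def)

lemma antipode_vertex: "antipode S (vertex S A) = vertex S (S - A)"
  by (auto simp: antipode_def vertex_def)

lemma sum_cube_level:
  assumes "finite S"
  shows "(\<Sum>\<eta> | \<eta> \<in> cube S \<and> weight S \<eta> = i. h \<eta>) = (\<Sum>A\<in>layer S i. h (vertex S A))"
proof (rule sum.reindex_bij_witness[where i = "vertex S" and j = "\<lambda>\<eta>. {i \<in> S. 0 < \<eta> i}"], goal_cases)
  case (2 \<eta>)
  then show ?case
    using weight_vertex[OF assms, of "{i \<in> S. 0 < \<eta> i}"] by (auto simp: vertex_support)
next
  case (3 A)
  then show ?case by (auto simp: vertex_def)
qed (use assms in \<open>auto simp: vertex_support vertex_in_cube weight_vertex\<close>)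

lemma antipodal_gamma_eq:
  assumes "finite S"
  shows "antipodal_gamma S \<nu> i
    = (\<Sum>A\<in>layer S i. pmf \<nu> (vertex S A) * pmf \<nu> (vertex S (S - A))) / real (card S choose i)"
  unfolding antipodal_gamma_def sum_cube_level[OF assms] antipode_vertex ..

lemma prob_weight_eq:
  assumes S: "finite S" and "set_pmf \<mu> \<subseteq> cube S"
  shows "measure_pmf.prob \<mu> {\<eta>. weight S \<eta> = i} = (\<Sum>A\<in>layer S i. pmf \<mu> (vertex S A))"
proof -
  have fin: "finite (cube S)"
    unfolding cube_def using S by (intro finite_PiE) auto
  \<comment> \<open>The event also contains functions outside the cube; cutting it down to the
    support makes it a finite set.\<close>
  have "{\<eta>. weight S \<eta> = i} \<inter> set_pmf \<mu> = {\<eta>. \<eta> \<in> cube S \<and> weight S \<eta> = i} \<inter> set_pmf \<mu>"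
    using assms by auto
  then have "measure_pmf.prob \<mu> {\<eta>. weight S \<eta> = i} = measure_pmf.prob \<mu> {\<eta>. \<eta> \<in> cube S \<and> weight S \<eta> = i}"
    by (metis measure_Int_set_pmf)
  also have "\<dots> = (\<Sum>\<eta> | \<eta> \<in> cube S \<and> weight S \<eta> = i. pmf \<mu> \<eta>)"
    using fin by (intro measure_measure_pmf_finite) auto
  finally show ?thesis
    by (simp add: sum_cube_level[OF S])
qed

section \<open>Conditioning and the APP\<close>

text \<open>A point of \<open>cube S\<close> is determined by its values on \<open>D\<close> and on
  \<open>S - D\<close>, so only \<open>vertex S (J \<union> E)\<close> in the conditioned support
  can restrict to \<open>vertex D E\<close>.\<close>

lemma pmf_conditioning_vertex:
  assumes supp: "set_pmf \<mu> \<subseteq> cube S" and "J \<subseteq> S - D" "D \<subseteq> S" "E \<subseteq> D"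
    and pos: "measure_pmf.prob \<mu> (agree_on (S - D) (vertex (S - D) J)) > 0"
  shows "pmf (conditioning S \<mu> (S - D) (vertex (S - D) J)) (vertex D E)
    = pmf \<mu> (vertex S (J \<union> E)) / measure_pmf.prob \<mu> (agree_on (S - D) (vertex (S - D) J))"
proof -
  let ?G = "agree_on (S - D) (vertex (S - D) J)" and ?z = "vertex S (J \<union> E)"
  have ne: "set_pmf \<mu> \<inter> ?G \<noteq> {}"
    using pos measure_Int_set_pmf[of \<mu> ?G] by (auto simp: Int_commute)
  have SD: "S - (S - D) = D"
    using assms by auto
  have z: "?z \<in> ?G" "restrict ?z D = vertex D E"
    using assms by (auto simp: agree_on_def vertex_def fun_eq_iff)
  have "\<eta> = ?z" if "\<eta> \<in> cube S" "\<eta> \<in> ?G" "restrict \<eta> D = vertex D E" for \<eta>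
  proof
    fix i
    consider "i \<in> D" | "i \<in> S - D" | "i \<notin> S"
      by blast
    then show "\<eta> i = ?z i"
    proof cases
      case 1
      then show ?thesis
        using fun_cong[OF trans[OF that(3) z(2)[symmetric]], of i] by simp
    next
      case 2
      then show ?thesis
        using that(2) z(1) by (simp add: agree_on_def)
    next
      case 3
      then show ?thesis
        using that(1) by (simp add: cube_def PiE_iff extensional_def vertex_def)
    qed
  qed
  then have eq: "(\<lambda>\<eta>. restrict \<eta> D) -` {vertex D E} \<inter> set_pmf (cond_pmf \<mu> ?G) = {?z} \<inter> set_pmf (cond_pmf \<mu> ?G)"
    using supp z by (auto simp: set_cond_pmf[OF ne])
  have "pmf (conditioning S \<mu> (S - D) (vertex (S - D) J)) (vertex D E)
      = measure_pmf.prob (cond_pmf \<mu> ?G) ((\<lambda>\<eta>. restrict \<eta> D) -` {vertex D E})"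
    by (simp add: conditioning_def SD pmf_map)
  also have "\<dots> = measure_pmf.prob (cond_pmf \<mu> ?G) {?z}"
    using arg_cong[OF eq, of "measure_pmf.prob (cond_pmf \<mu> ?G)"] by (simp add: measure_Int_set_pmf)
  also have "\<dots> = pmf \<mu> ?z / measure_pmf.prob \<mu> ?G"
    using z by (simp add: measure_pmf_single pmf_cond[OF ne])
  finally show ?thesis .
qed

text \<open>This supplies the premise \<open>app\<close> of \<open>log_concave_of_antipodal\<close>.
  The probability of the conditioning event enters both values of gamma as the same inverse square
  and cancels.\<close>

lemma antipodal_sums_of_APP:
  assumes S: "finite S" and supp: "set_pmf \<mu> \<subseteq> cube S" and J: "J \<subseteq> S" "D \<subseteq> S" "J \<inter> D = {}"
    and k: "card D = 2 * k" "1 \<le> k"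
    and app: "measure_pmf.prob \<mu> (agree_on (S - D) (vertex (S - D) J)) > 0 \<Longrightarrow>
      APP D (conditioning S \<mu> (S - D) (vertex (S - D) J))"
  shows "(real k + 1) * (\<Sum>E\<in>layer D (k - 1). pmf \<mu> (vertex S (J \<union> E)) * pmf \<mu> (vertex S (J \<union> (D - E))))
    \<le> real k * (\<Sum>E\<in>layer D k. pmf \<mu> (vertex S (J \<union> E)) * pmf \<mu> (vertex S (J \<union> (D - E))))"
proof -
  let ?G = "agree_on (S - D) (vertex (S - D) J)"
  let ?p = "measure_pmf.prob \<mu> ?G" and ?\<nu> = "conditioning S \<mu> (S - D) (vertex (S - D) J)"
  let ?M = "\<lambda>i. \<Sum>E\<in>layer D i. pmf \<mu> (vertex S (J \<union> E)) * pmf \<mu> (vertex S (J \<union> (D - E)))"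
  have JD: "J \<subseteq> S - D"
    using J by auto
  have D: "finite D"
    using S J finite_subset by blast
  show ?thesis
  proof (cases "?p > 0")
    \<comment> \<open>Conditioning on a null event is meaningless, but then every point in the two
      sums has mass 0 and the claim is \<open>0 \<le> 0\<close>.\<close>
    case False
    have "pmf \<mu> (vertex S (J \<union> E)) = 0" if "E \<subseteq> D" for E
    proof -
      have "vertex S (J \<union> E) \<in> ?G"
        using that J by (auto simp: agree_on_def vertex_def)
      then have "pmf \<mu> (vertex S (J \<union> E)) \<le> ?p"
        unfolding measure_pmf_single[symmetric] by (intro measure_pmf.finite_measure_mono) auto
      then show ?thesis
        using False pmf_nonneg[of \<mu> "vertex S (J \<union> E)"] by linarith
    qed
    then have "?M i = 0" for i
      by (intro sum.neutral) auto
    then show ?thesis by simp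
  next
    case True
    have gamma: "antipodal_gamma D ?\<nu> i = ?M i / ?p\<^sup>2 / real (2 * k choose i)" for i
    proof -
      have "antipodal_gamma D ?\<nu> i
          = (\<Sum>E\<in>layer D i. pmf ?\<nu> (vertex D E) * pmf ?\<nu> (vertex D (D - E))) / real (2 * k choose i)"
        by (simp add: antipodal_gamma_eq[OF D] k)
      also have "(\<Sum>E\<in>layer D i. pmf ?\<nu> (vertex D E) * pmf ?\<nu> (vertex D (D - E)))
          = (\<Sum>E\<in>layer D i. pmf \<mu> (vertex S (J \<union> E)) * pmf \<mu> (vertex S (J \<union> (D - E))) / ?p\<^sup>2)"
        using pmf_conditioning_vertex[OF supp JD J(2) _ True]
        by (intro sum.cong) (auto simp: power2_eq_square)
      finally show ?thesis
        by (simp add: sum_divide_distrib)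
    qed
    \<comment> \<open>The \<open>k\<close> whose existence \<open>APP\<close> asserts is the present
      one, because \<open>card D = 2 * k\<close> determines it.\<close>
    have "antipodal_gamma D ?\<nu> (k - 1) \<le> antipodal_gamma D ?\<nu> k"
      using app[OF True] k by (auto simp: APP_def)
    then have "?M (k - 1) / ?p\<^sup>2 / real (2 * k choose (k - 1)) \<le> ?M k / ?p\<^sup>2 / real (2 * k choose k)"
      by (simp only: gamma)
    then have le: "?M (k - 1) / real (2 * k choose (k - 1)) \<le> ?M k / real (2 * k choose k)"
      using True by (simp add: divide_simps split: if_splits)
    obtain m where m: "k = Suc m"
      using k by (cases k) auto
    have pos: "real (2 * k choose k) > 0" "real (2 * k choose (k - 1)) > 0"
      by simp_all
    have "real k * real (2 * k choose k) = (real k + 1) * real (2 * k choose (k - 1))"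
      using binomial_Suc_step[of m "2 * k"] m by (simp add: algebra_simps)
    then have "real (2 * k choose k) * (real k * ?M k) = (real k + 1) * (real (2 * k choose (k - 1)) * ?M k)"
      by (simp only: mult.assoc[symmetric]) (simp only: mult_ac)
    also have "\<dots> \<ge> (real k + 1) * (real (2 * k choose k) * ?M (k - 1))"
      using le pos by (intro mult_left_mono) (simp_all add: divide_le_eq le_divide_eq mult_ac)
    finally have "real (2 * k choose k) * ((real k + 1) * ?M (k - 1)) \<le> real (2 * k choose k) * (real k * ?M k)"
      by (simp only: mult_ac)
    then show ?thesis
      using pos(1) by (simp only: mult_le_cancel_left_pos)
  qed
qed

section \<open>The two ranges of indices\<close>

theorem theorem2p1:
  fixes \<mu> :: "(nat \<Rightarrow> nat) pmf" and n t :: nat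
  assumes "set_pmf \<mu> \<subseteq> cube {1..n}"
    and "t > 0"
    and "\<And>k I \<xi>. \<lbrakk> k \<in> {1..t}; 2 * k \<le> n; I \<subseteq> {1..n}; card I = n - 2 * k; \<xi> \<in> cube I;
            measure_pmf.prob \<mu> (agree_on I \<xi>) > 0 \<rbrakk>
          \<Longrightarrow> APP ({1..n} - I) (conditioning {1..n} \<mu> I \<xi>)"
  shows "log_concave_between 0 (t + 1) (normalized_rank n \<mu>)
       \<and> log_concave_between (n - (t + 1)) n (normalized_rank n \<mu>)"
proof -
  let ?S = "{1..n}"
  have rank: "normalized_rank n \<mu> = (\<lambda>i. (\<Sum>A\<in>layer ?S i. pmf \<mu> (vertex ?S A)) / real (card ?S choose i))"
    unfolding normalized_rank_def prob_weight_eq[OF finite_atLeastAtMost assms(1)] by simp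
  \<comment> \<open>Both ranges are treated at once: only \<open>k \<le> j\<close> and
    \<open>k \<le> n - j\<close> occur, so either alternative gives \<open>k \<le> t\<close>, and
    \<open>2 * k \<le> n\<close> follows as well.\<close>
  have lc: "normalized_rank n \<mu> (j - 1) * normalized_rank n \<mu> (j + 1) \<le> (normalized_rank n \<mu> j)\<^sup>2"
    if j: "0 < j" "j < n" "j \<le> t \<or> n - j \<le> t" for j
    unfolding rank
  proof (rule log_concave_of_antipodal)
    fix k and J D :: "nat set"
    assume *: "1 \<le> k" "k \<le> j" "k \<le> card ?S - j" "J \<subseteq> ?S" "D \<subseteq> ?S" "J \<inter> D = {}" "card D = 2 * k"
    have "?S - (?S - D) = D"
      using * by auto
    moreover have "card (?S - D) = n - 2 * k"
      using * by (subst card_Diff_subset) (auto intro: finite_subset)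
    ultimately have "APP D (conditioning ?S \<mu> (?S - D) (vertex (?S - D) J))"
      if "measure_pmf.prob \<mu> (agree_on (?S - D) (vertex (?S - D) J)) > 0"
      using assms(3)[of k "?S - D" "vertex (?S - D) J"] that * j by (auto simp: vertex_in_cube)
    then show "(real k + 1) * (\<Sum>E\<in>layer D (k - 1). pmf \<mu> (vertex ?S (J \<union> E)) * pmf \<mu> (vertex ?S (J \<union> (D - E))))
        \<le> real k * (\<Sum>E\<in>layer D k. pmf \<mu> (vertex ?S (J \<union> E)) * pmf \<mu> (vertex ?S (J \<union> (D - E))))"
      using * assms(1) by (intro antipodal_sums_of_APP) auto
  qed (use j in auto)
  show ?thesis
    unfolding log_concave_between_def
  proof (intro conjI allI impI)
    fix j assume j: "0 < j \<and> j < t + 1"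
    show "normalized_rank n \<mu> (j - 1) * normalized_rank n \<mu> (j + 1) \<le> (normalized_rank n \<mu> j)\<^sup>2"
    proof (cases "j < n")
      case True
      then show ?thesis using lc j by auto
    next
      \<comment> \<open>Since \<open>t + 1\<close> may exceed \<open>n\<close>, indices
        \<open>j \<ge> n\<close> can occur; there \<open>n choose (j + 1) = 0\<close>, and division
        by zero yields 0.\<close>
      case False
      then have "normalized_rank n \<mu> (j + 1) = 0"
        by (simp add: normalized_rank_def)
      then show ?thesis by simp
    qed
  next
    \<comment> \<open>Even when the subtraction truncates to 0, these bounds give
      \<open>0 < j\<close> and \<open>n - j \<le> t\<close>.\<close>
    fix j assume "n - (t + 1) < j \<and> j < n"
    then show "normalized_rank n \<mu> (j - 1) * normalized_rank n \<mu> (j + 1) \<le> (normalized_rank n \<mu> j)\<^sup>2"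
      by (intro lc) auto
  qed
qed

end
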